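(* Let $X$ be a Hausdorff locally convex topological vector space, let $K$ be a nonempty convex compact subset of $X$, let $D\subseteq K$ be a self segment-dense set in $K$, and let $F:K\times K\rightrightarrows\mathbb{R}$ be a set-valued map satisfying: (i) for all $y\in D$, the map $x\mapsto F(x,y)$ is upper semicontinuous on $K$; (ii) for all $x\in K$, the map $y\mapsto F(x,y)$ is upper semicontinuous on $K\setminus D$; (iii) for all $x\in D$, the map $y\mapsto F(x,y)$ is concave on $D$; (iv) for all $x\in D$, $F(x,x)\cap\mathbb{R}_+\neq\emptyset$. Then there exists $x_0\in K$ such that $F(x_0,y)\cap\mathbb{R}_+\neq\emptyset$ for all $y\in K$.
   Context: Self segment-dense: for $U\subseteq V\subseteq X$ with $V$ convex, $U$ is self segment-dense in $V$ if $U$ is dense in $V$ (i.e. $V\subseteq\operatorname{cl}(U)$) and for all $x,y\in U$ the set $[x,y]\cap U$ is dense in the closed segment $[x,y]=\{x+t(y-x):t\in[0,1]\}$. Notation: $\mathbb{R}_+=[0,\infty)$. Upper semicontinuity: a set-valued map $T:A\rightrightarrows\mathbb{R}$ on a topological space $A$ (here $A=K$ with the subspace topology), with domain $D(T)=\{x\in A:T(x)\ne\emptyset\}$, is upper semicontinuous at $x\in D(T)$ if for every open $N\subseteq\mathbb{R}$ with $T(x)\subseteq N$ there is a neighborhood $M$ of $x$ in $A$ such that $T(y)\subseteq N$ for all $y\in M$. It is upper semicontinuous on $S\subseteq A$ if it is upper semicontinuous at every point of $S$ (so in particular $S\subseteq D(T)$); here $T$ is still regarded as a map on all of $A$. Concavity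 on a not necessarily convex set: $T$ is concave on $D$ if for all $x_1,\dots,x_n\in D$ and $\lambda_i\ge0$ with $\sum_{i=1}^n\lambda_i=1$ and $\sum_{i=1}^n\lambda_ix_i\in D$ one has $\sum_{i=1}^n\lambda_iT(x_i)\supseteq T\left(\sum_{i=1}^n\lambda_ix_i\right)$ (Minkowski sum). *)

theory Defs
  imports "HOL-Analysis.Analysis" "HOL-Library.Set_Algebras"
begin

class topological_real_vector = real_vector + topological_ab_group_add +
  assumes tendsto_scaleR_Pair:
    "LIM p (nhds c \<times>\<^sub>F nhds a). fst p *\<^sub>R snd p :> nhds (c *\<^sub>R a)"

text \<open>
  The constant \<^const>\<open>convex\<close> cannot be used inside a class specification, so its definition
  is written out here and folded back in lemma \<open>convex_nhds_zero\<close>.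
\<close>

class locally_convex_space = topological_real_vector +
  assumes ex_convex_nhds_zero:
    "open U \<Longrightarrow> 0 \<in> U \<Longrightarrow>
     \<exists>V. open V \<and> (\<forall>x\<in>V. \<forall>y\<in>V. \<forall>u\<ge>0. \<forall>v\<ge>0. u + v = 1 \<longrightarrow> u *\<^sub>R x + v *\<^sub>R y \<in> V) \<and>
         0 \<in> V \<and> V \<subseteq> U"

lemma convex_nhds_zero:
  fixes U :: "'a::locally_convex_space set"
  assumes "open U" "0 \<in> U"
  shows "\<exists>V. open V \<and> convex V \<and> 0 \<in> V \<and> V \<subseteq> U"
  using ex_convex_nhds_zero[OF assms] unfolding convex_def .

instance real_normed_vector \<subseteq> topological_real_vector
proof
  fix c :: real and a :: 'a
  show "LIM p (nhds c \<times>\<^sub>F nhds a). fst p *\<^sub>R snd p :> nhds (c *\<^sub>R a)"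
    by (intro tendsto_scaleR filterlim_fst filterlim_snd)
qed

instance real_normed_vector \<subseteq> locally_convex_space
proof
  fix U :: "'a set"
  assume "open U" "0 \<in> U"
  then obtain e where "e > 0" "ball 0 e \<subseteq> U"
    by (meson open_contains_ball)
  then have "\<exists>V. open V \<and> convex V \<and> 0 \<in> V \<and> V \<subseteq> U"
    by (intro exI[of _ "ball 0 e"]) auto
  then show "\<exists>V. open V \<and> (\<forall>x\<in>V. \<forall>y\<in>V. \<forall>u\<ge>0. \<forall>v\<ge>0. u + v = 1 \<longrightarrow> u *\<^sub>R x + v *\<^sub>R y \<in> V) \<and>
      0 \<in> V \<and> V \<subseteq> U"
    unfolding convex_def .
qed

definition self_segment_dense ::
    "'a::{real_vector, topological_space} set \<Rightarrow> 'a set \<Rightarrow> bool" where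
  "self_segment_dense U V \<longleftrightarrow>
     U \<subseteq> V \<and> convex V \<and> V \<subseteq> closure U \<and>
     (\<forall>x\<in>U. \<forall>y\<in>U. closed_segment x y \<subseteq> closure (closed_segment x y \<inter> U))"

text \<open>
  A set-valued map on \<^term>\<open>A\<close> is represented by a total function whose values outside
  \<^term>\<open>A\<close> are irrelevant; neighbourhoods are taken in the subspace topology of
  \<^term>\<open>A\<close>.
\<close>

definition usc_at ::
    "'a::topological_space set \<Rightarrow> ('a \<Rightarrow> 'b::topological_space set) \<Rightarrow> 'a \<Rightarrow> bool" where
  "usc_at A T x \<longleftrightarrow>
     x \<in> A \<and> T x \<noteq> {} \<and>
     (\<forall>N. open N \<and> T x \<subseteq> N \<longrightarrow>
        (\<exists>M. openin (top_of_set A) M \<and> x \<in> M \<and> (\<forall>y\<in>M. T y \<subseteq> N)))"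

text \<open>
  The map stays a map on all of \<^term>\<open>A\<close>: the neighbourhoods of a point of
  \<^term>\<open>S\<close> are not cut down to \<^term>\<open>S\<close>.
\<close>

definition usc_on ::
    "'a::topological_space set \<Rightarrow> ('a \<Rightarrow> 'b::topological_space set) \<Rightarrow> 'a set \<Rightarrow> bool" where
  "usc_on A T S \<longleftrightarrow> (\<forall>x\<in>S. usc_at A T x)"

text \<open>
  The set \<^term>\<open>D\<close> need not be convex. The last sum is a Minkowski sum of sets and
  \<open>*o\<close> dilates a set by a scalar; in particular \<open>0 *o {} = {}\<close>.
\<close>

definition set_concave_on :: "'a::real_vector set \<Rightarrow> ('a \<Rightarrow> real set) \<Rightarrow> bool" where
  "set_concave_on D T \<longleftrightarrow>
     (\<forall>n (x :: nat \<Rightarrow> 'a) (l :: nat \<Rightarrow> real).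
        (\<forall>i<n. x i \<in> D \<and> 0 \<le> l i) \<and> (\<Sum>i<n. l i) = 1 \<and> (\<Sum>i<n. l i *\<^sub>R x i) \<in> D \<longrightarrow>
        T (\<Sum>i<n. l i *\<^sub>R x i) \<subseteq> (\<Sum>i<n. l i *o T (x i)))"

end

theory Submission
  imports Defs
begin

text \<open>
  The sets \<open>G y = {x \<in> K. F x y \<inter> {0..} \<noteq> {}}\<close> with \<open>y \<in> D\<close> are closed and satisfy the
  Knaster--Kuratowski--Mazurkiewicz condition: concavity gives \<open>convex hull B \<inter> D \<subseteq> (\<Union>y\<in>B. G y)\<close>
  for finite \<open>B \<subseteq> D\<close>, and self segment-density makes \<open>D\<close> dense in \<open>convex hull B\<close>. So they have a
  common point \<open>x0\<close>; upper semicontinuity in the second variable and density of \<open>D\<close> extend the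
  conclusion from \<open>D\<close> to \<open>K\<close>. The finite KKM theorem comes from Kuhn's combinatorial lemma on the
  cube, which maps onto the simplex by \<open>t \<mapsto> (t j * (\<Prod>i<j. 1 - t i))\<close>. Under this map a vertex
  label of the simplex meets the boundary conditions of Kuhn's lemma: \<open>t j = 0\<close> excludes the
  label \<open>j\<close>, and \<open>t j = 1\<close> excludes all labels above \<open>j\<close>.
\<close>

lemma tendsto_scaleR_topological [tendsto_intros]:
  fixes g :: "'b \<Rightarrow> 'a::topological_real_vector"
  assumes "(f \<longlongrightarrow> c) F" "(g \<longlongrightarrow> a) F"
  shows "((\<lambda>x. f x *\<^sub>R g x) \<longlongrightarrow> c *\<^sub>R a) F"
  using filterlim_compose[OF tendsto_scaleR_Pair filterlim_Pair[OF assms]] by simp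

section \<open>The KKM theorem for finitely many closed sets\<close>

text \<open>Telescoping: each term is the drop from one partial product to the next. A single
  \<open>t i = 1\<close> therefore makes the weights sum to 1.\<close>

lemma sum_stick_breaking:
  fixes t :: "nat \<Rightarrow> 'a::comm_ring_1"
  shows "(\<Sum>j\<le>n. t j * (\<Prod>i<j. 1 - t i)) = 1 - (\<Prod>i\<le>n. 1 - t i)"
  by (induction n) (simp_all add: algebra_simps lessThan_Suc_atMost)

text \<open>Kuhn's lemma for one integer label per grid point: \<open>q\<close> is the base corner
  of a fully labelled simplex and \<open>r i\<close> its vertex with label \<open>i\<close>.\<close>

lemma kuhn_full_cell:
  fixes k :: "(nat \<Rightarrow> nat) \<Rightarrow> nat"
  assumes "0 < p"
    and k_le: "\<And>x. (\<And>j. x j \<le> p) \<Longrightarrow> k x \<le> n"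
    and k_pos: "\<And>x. (\<And>j. x j \<le> p) \<Longrightarrow> k x < n \<Longrightarrow> x (k x) \<noteq> 0"
    and k_top: "\<And>x j. (\<And>j. x j \<le> p) \<Longrightarrow> j < n \<Longrightarrow> x j = p \<Longrightarrow> k x \<le> j"
  obtains q r where "\<And>j. q j \<le> p"
    and "\<And>i j. i \<le> n \<Longrightarrow> r i j \<le> p"
    and "\<And>i j. i \<le> n \<Longrightarrow> q j \<le> r i j \<and> r i j \<le> Suc (q j)"
    and "\<And>i. i \<le> n \<Longrightarrow> k (r i) = i"
proof -
  \<comment> \<open>The constant \<^const>\<open>reduced\<close> returns the first nonzero entry of a 0/1-labelling, which is \<open>k x\<close> here.\<close>
  define lab where "lab x j = (if j < k x \<or> x j = 0 then 0 else 1::nat)" for x j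
  have red: "reduced n (lab x) = k x" if "\<And>j. x j \<le> p" for x
    unfolding reduced_def using k_le[of x] k_pos[of x] that
    by (intro Least_equality) (auto simp: lab_def not_less dest: le_neq_implies_less split: if_splits)
  have "odd (card {s. ksimplex p n s \<and> (reduced n \<circ> lab) ` s = {..n}})"
    using \<open>0 < p\<close> k_top by (intro kuhn_combinatorial) (auto simp: lab_def not_less[symmetric])
  then have "{s. ksimplex p n s \<and> (reduced n \<circ> lab) ` s = {..n}} \<noteq> {}"
    by (rule odd_card_imp_not_empty)
  then obtain s b u where "kuhn_simplex p n b u s" and s: "(reduced n \<circ> lab) ` s = {..n}"
    by (auto elim: ksimplex.cases)
  interpret kuhn_simplex p n b u s by fact
  have "\<exists>x\<in>s. reduced n (lab x) = i" if "i \<le> n" for i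
    using s that by (metis atMost_iff comp_apply imageE)
  then obtain r where r: "\<And>i. i \<le> n \<Longrightarrow> r i \<in> s \<and> reduced n (lab (r i)) = i"
    by metis
  \<comment> \<open>The base is below \<open>p\<close> in the first \<open>n\<close> coordinates and
    equal to \<open>p\<close> in all others.\<close>
  have "b j \<le> p" for j
    using base base_out[of j] by (cases "j < n") (auto simp: less_imp_le Pi_iff)
  with that[of b r] r s_le_p base_le le_Suc_base red show thesis
    by metis
qed

text \<open>Fully labelled cells of ever finer grids shrink to one point \<open>s\<close> of the
  cube, and closedness puts its image into every \<open>G i\<close>. Limits are taken in the cube,
  so sequences suffice.\<close>

lemma KKM_sequence:
  fixes y :: "nat \<Rightarrow> 'a::topological_real_vector"
  assumes cl: "\<And>i. i \<le> n \<Longrightarrow> closed (G i)"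
    and cover: "\<And>l. (\<And>i. i \<le> n \<Longrightarrow> 0 \<le> l i) \<Longrightarrow> (\<Sum>i\<le>n. l i) = 1 \<Longrightarrow>
      \<exists>i\<le>n. 0 < l i \<and> (\<Sum>j\<le>n. l j *\<^sub>R y j) \<in> G i"
  shows "(\<Inter>i\<le>n. G i) \<noteq> {}"
proof -
  \<comment> \<open>The last coordinate is set to 1 so that the weights \<open>l\<close> sum to 1.\<close>
  define t where "t p x j = (if j < n then real (x j) / real p else 1)"
    for p :: nat and x :: "nat \<Rightarrow> nat" and j
  define l where "l s j = s j * (\<Prod>i<j. 1 - s i)" for s :: "nat \<Rightarrow> real" and j
  define \<Phi> where "\<Phi> s = (\<Sum>j\<le>n. l s j *\<^sub>R y j)" for s
  have l_nonneg: "0 \<le> l (t p x) i" if "\<And>j. x j \<le> p" for p x i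
  proof -
    have "0 \<le> t p x j \<and> t p x j \<le> 1" for j
      using that[of j] by (auto simp: t_def divide_le_eq_1)
    then show ?thesis
      unfolding l_def by (intro mult_nonneg_nonneg prod_nonneg) auto
  qed
  have l_sum: "(\<Sum>i\<le>n. l (t p x) i) = 1" for p x
    unfolding l_def sum_stick_breaking by (auto simp: t_def intro: prod_zero)
  define k where "k p x = (SOME i. i \<le> n \<and> 0 < l (t p x) i \<and> \<Phi> (t p x) \<in> G i)" for p x
  have k: "k p x \<le> n \<and> 0 < l (t p x) (k p x) \<and> \<Phi> (t p x) \<in> G (k p x)" if "\<And>j. x j \<le> p" for p x
    unfolding k_def \<Phi>_def by (rule someI_ex) (use cover[of "l (t p x)"] l_nonneg[OF that] l_sum in auto)
  have k_pos: "x (k p x) \<noteq> 0" if "\<And>j. x j \<le> p" "k p x < n" for p x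
  proof
    assume "x (k p x) = 0"
    then have "l (t p x) (k p x) = 0"
      using that by (simp add: l_def t_def)
    with k[of x p] that(1) show False by simp
  qed
  have k_top: "k p x \<le> j" if "0 < p" "\<And>j. x j \<le> p" "j < n" "x j = p" for p x j
  proof (rule ccontr)
    assume "\<not> k p x \<le> j"
    moreover have "t p x j = 1" using that by (simp add: t_def)
    ultimately have "l (t p x) (k p x) = 0"
      by (auto simp: l_def)
    with k[of x p] that(2) show False by simp
  qed
  have "\<exists>q r. (\<forall>j. q j \<le> Suc m) \<and> (\<forall>i\<le>n. \<forall>j. r i j \<le> Suc m) \<and>
     (\<forall>i\<le>n. \<forall>j. q j \<le> r i j \<and> r i j \<le> Suc (q j)) \<and> (\<forall>i\<le>n. k (Suc m) (r i) = i)" for m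
    by (rule kuhn_full_cell[of "Suc m" "k (Suc m)" n])
       (use k[of _ "Suc m"] k_pos[of _ "Suc m"] k_top[of "Suc m"] in \<open>blast+\<close>)
  then obtain q r where q: "\<And>m j. q m j \<le> Suc m" and rp: "\<And>m i j. i \<le> n \<Longrightarrow> r m i j \<le> Suc m"
    and qr: "\<And>m i j. i \<le> n \<Longrightarrow> q m j \<le> r m i j \<and> r m i j \<le> Suc (q m j)"
    and kr: "\<And>m i. i \<le> n \<Longrightarrow> k (Suc m) (r m i) = i"
    by metis
  \<comment> \<open>A countable product of intervals is compact and metrizable, so one subsequence
    of base corners converges in all coordinates at once.\<close>
  have "compact (PiE UNIV (\<lambda>_. {0..1}) :: (nat \<Rightarrow> real) set)"
    using compactin_PiE[of "\<lambda>_. euclidean" "UNIV :: nat set" "\<lambda>_. {0..1::real}"]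
    by (simp add: euclidean_product_topology)
  then have "seq_compact (PiE UNIV (\<lambda>_. {0..1}) :: (nat \<Rightarrow> real) set)"
    by (simp add: compact_eq_seq_compact_metric)
  moreover have "\<forall>m. t (Suc m) (q m) \<in> PiE UNIV (\<lambda>_. {0..1})"
    using q by (auto simp: t_def divide_le_eq_1 simp del: of_nat_Suc)
  ultimately obtain s \<sigma> where \<sigma>: "strict_mono \<sigma>" and lim: "((\<lambda>m. t (Suc m) (q m)) \<circ> \<sigma>) \<longlonglongrightarrow> s"
    by (rule seq_compactE) blast
  have limj: "(\<lambda>m. t (Suc (\<sigma> m)) (q (\<sigma> m)) j) \<longlonglongrightarrow> s j" for j
  proof -
    have "isCont (\<lambda>x::nat\<Rightarrow>real. x j) s"
      by (rule continuous_on_interior[OF continuous_on_product_coordinates]) simp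
    from isCont_tendsto_compose[OF this lim] show ?thesis by (simp add: o_def)
  qed
  have "\<Phi> s \<in> G i" if i: "i \<le> n" for i
  proof -
    have inv: "(\<lambda>m. 1 / real (Suc (\<sigma> m))) \<longlonglongrightarrow> 0"
      using LIMSEQ_subseq_LIMSEQ[OF LIMSEQ_inverse_real_of_nat \<sigma>] by (simp add: o_def inverse_eq_divide)
    \<comment> \<open>Each vertex is within one mesh width of the base corner, so the limit
      \<open>s\<close> is the same for all labels \<open>i\<close>.\<close>
    have "(\<lambda>m. t (Suc (\<sigma> m)) (r (\<sigma> m) i) j) \<longlonglongrightarrow> s j" for j
    proof (rule tendsto_sandwich[OF _ _ limj[of j]])
      show "(\<lambda>m. t (Suc (\<sigma> m)) (q (\<sigma> m)) j + 1 / real (Suc (\<sigma> m))) \<longlonglongrightarrow> s j"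
        using tendsto_add[OF limj[of j] inv] by simp
      have *: "real (q m j) \<le> real (r m i j)" "real (r m i j) \<le> real (q m j) + 1" for m
        using qr[OF i, of m j] by linarith+
      show "\<forall>\<^sub>F m in sequentially. t (Suc (\<sigma> m)) (q (\<sigma> m)) j \<le> t (Suc (\<sigma> m)) (r (\<sigma> m) i) j"
        using * by (auto simp: t_def divide_right_mono)
      show "\<forall>\<^sub>F m in sequentially. t (Suc (\<sigma> m)) (r (\<sigma> m) i) j
          \<le> t (Suc (\<sigma> m)) (q (\<sigma> m)) j + 1 / real (Suc (\<sigma> m))"
        using * by (auto simp: t_def divide_right_mono simp flip: add_divide_distrib)
    qed
    then have "(\<lambda>m. \<Phi> (t (Suc (\<sigma> m)) (r (\<sigma> m) i))) \<longlonglongrightarrow> \<Phi> s"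
      unfolding \<Phi>_def l_def by (intro tendsto_intros)
    moreover have "\<Phi> (t (Suc (\<sigma> m)) (r (\<sigma> m) i)) \<in> G i" for m
      using k[of "r (\<sigma> m) i" "Suc (\<sigma> m)"] rp[OF i] kr[OF i] by simp
    ultimately show ?thesis
      using cl[OF i] by (intro Lim_in_closed_set[of "G i" _ sequentially]) auto
  qed
  then show ?thesis by auto
qed

lemma KKM_finite:
  fixes G :: "'a::topological_real_vector \<Rightarrow> 'a set"
  assumes "finite A" and cl: "\<And>a. a \<in> A \<Longrightarrow> closed (G a)"
    and cover: "\<And>B. B \<subseteq> A \<Longrightarrow> convex hull B \<subseteq> (\<Union>a\<in>B. G a)"
  shows "(\<Inter>a\<in>A. G a) \<noteq> {}"
proof (cases "A = {}")
  case False
  \<comment> \<open>The index set \<open>{..n}\<close> has \<open>n + 1\<close> elements, hence the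
    shift.\<close>
  define n where "n = card A - 1"
  have "card {..n} = card A"
    using False \<open>finite A\<close> by (simp add: n_def card_gt_0_iff)
  then obtain h where h: "bij_betw h {..n} A"
    using \<open>finite A\<close> finite_same_card_bij by blast
  have "(\<Inter>i\<le>n. G (h i)) \<noteq> {}"
  proof (rule KKM_sequence[where y = h])
    show "closed (G (h i))" if "i \<le> n" for i
      using cl h that by (auto simp: bij_betw_def)
    fix l :: "nat \<Rightarrow> real"
    assume l: "\<And>i. i \<le> n \<Longrightarrow> 0 \<le> l i" "(\<Sum>i\<le>n. l i) = 1"
    \<comment> \<open>Applying \<open>cover\<close> to the face spanned by the support of
      \<open>l\<close> produces an index of positive weight.\<close>
    define I where "I = {i. i \<le> n \<and> 0 < l i}"
    have I: "finite I" "I \<subseteq> {..n}" "\<forall>i\<in>{..n} - I. l i = 0"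
      using l(1) by (force simp: I_def le_less)+
    have "(\<Sum>i\<le>n. l i) = (\<Sum>i\<in>I. l i)" "(\<Sum>i\<le>n. l i *\<^sub>R h i) = (\<Sum>i\<in>I. l i *\<^sub>R h i)"
      using I by (auto intro!: sum.mono_neutral_right)
    moreover have "(\<Sum>i\<in>I. l i *\<^sub>R h i) \<in> convex hull (h ` I)"
      using I(1) l calculation(1)
      by (intro convex_sum) (auto simp: convex_convex_hull I_def hull_inc)
    moreover have "convex hull (h ` I) \<subseteq> (\<Union>a\<in>h ` I. G a)"
      using h I(2) by (intro cover) (auto simp: bij_betw_def)
    ultimately have "(\<Sum>i\<le>n. l i *\<^sub>R h i) \<in> (\<Union>a\<in>h ` I. G a)"
      by (metis subsetD)
    then show "\<exists>i\<le>n. 0 < l i \<and> (\<Sum>j\<le>n. l j *\<^sub>R h j) \<in> G (h i)"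
      by (auto simp: I_def)
  qed
  moreover have "(\<Inter>a\<in>A. G a) = (\<Inter>i\<le>n. G (h i))"
    using h by (auto simp: bij_betw_def)
  ultimately show ?thesis by simp
qed simp

text \<open>Induction on \<open>B\<close>: a point of the larger hull lies on a segment from
  \<open>a\<close> to some \<open>b\<close> in the old hull, and \<open>b\<close> is a limit of
  points of \<open>D\<close>, for which the segment condition is available.\<close>

lemma self_segment_dense_convex_hull:
  fixes D :: "'a::topological_real_vector set"
  assumes "self_segment_dense D K" "finite B" "B \<subseteq> D"
  shows "convex hull B \<subseteq> closure (convex hull B \<inter> D)"
  using assms(2,3)
proof (induction B rule: finite_induct)
  case (insert a B)
  show ?case
  proof (cases "B = {}")
    case True
    then show ?thesis using insert.prems by (simp add: closure_subset)
  next
    case False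
    let ?C = "convex hull (insert a B)"
    show ?thesis
    proof
      fix x assume "x \<in> ?C"
      then obtain u v b where uv: "u \<ge> 0" "v \<ge> 0" "u + v = 1" and b: "b \<in> convex hull B"
        and x: "x = u *\<^sub>R a + v *\<^sub>R b"
        unfolding convex_hull_insert[OF False] by blast
      \<comment> \<open>The ratio \<open>u : v\<close> stays fixed while the endpoint
        \<open>z\<close> runs through \<open>D\<close> towards \<open>b\<close>; continuity of
        \<open>\<phi>\<close> carries the closure along.\<close>
      define \<phi> where "\<phi> z = u *\<^sub>R a + v *\<^sub>R z" for z
      have "\<phi> z \<in> closure (?C \<inter> D)" if "z \<in> convex hull B \<inter> D" for z
      proof -
        have "a \<in> ?C" "z \<in> ?C"
          using that hull_mono[of B "insert a B" convex] by (auto intro: hull_inc)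
        then have "closed_segment a z \<subseteq> ?C"
          by (simp add: closed_segment_subset convex_convex_hull)
        moreover have "\<phi> z \<in> closed_segment a z"
          using uv unfolding \<phi>_def in_segment by (intro exI[of _ v]) (auto simp: algebra_simps simp flip: scaleR_add_left)
        moreover have "closed_segment a z \<subseteq> closure (closed_segment a z \<inter> D)"
          using assms(1) insert.prems that unfolding self_segment_dense_def by blast
        ultimately show ?thesis
          using closure_mono[of "closed_segment a z \<inter> D" "?C \<inter> D"] by blast
      qed
      moreover have "continuous_on UNIV \<phi>"
        unfolding \<phi>_def continuous_on_def by (auto intro!: tendsto_intros)
      ultimately have "\<phi> ` closure (convex hull B \<inter> D) \<subseteq> closure (?C \<inter> D)"
        by (intro image_closure_subset) (auto intro: continuous_on_subset)
      with insert b show "x \<in> closure (?C \<inter> D)"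
        unfolding x \<phi>_def by blast
    qed
  qed
qed simp

section \<open>Upper semicontinuity and concavity of set-valued maps\<close>

text \<open>The complement is where \<open>T x\<close> lies in the open set \<open>- C\<close>, and
  upper semicontinuity makes that relatively open.\<close>

lemma closedin_usc_meets:
  assumes "usc_on A T A" "closed C"
  shows "closedin (top_of_set A) {x\<in>A. T x \<inter> C \<noteq> {}}"
proof -
  have "\<exists>M. openin (top_of_set A) M \<and> x \<in> M \<and> M \<subseteq> {x\<in>A. T x \<inter> C = {}}"
    if x: "x \<in> A" "T x \<inter> C = {}" for x
  proof -
    have "open (- C)" "T x \<subseteq> - C" using assms(2) x by auto
    then obtain M where "openin (top_of_set A) M" "x \<in> M" "\<forall>y\<in>M. T y \<subseteq> - C"
      using assms(1) x(1) unfolding usc_on_def usc_at_def by meson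
    then show ?thesis
      by (intro exI[of _ M]) (auto dest: openin_imp_subset)
  qed
  then have "openin (top_of_set A) {x\<in>A. T x \<inter> C = {}}"
    by (subst openin_subopen) auto
  moreover have "{x\<in>A. T x \<inter> C \<noteq> {}} = A - {x\<in>A. T x \<inter> C = {}}" by auto
  ultimately show ?thesis
    by (simp add: closedin_diff)
qed

text \<open>If every \<open>T b\<close> consisted of negative numbers, so would their Minkowski
  convex combination, which contains \<open>T x\<close>.\<close>

lemma set_concave_on_nonneg:
  assumes "set_concave_on D T" "finite B" "B \<subseteq> D" "x \<in> convex hull B" "x \<in> D" "T x \<inter> {0..} \<noteq> {}"
  shows "\<exists>b\<in>B. T b \<inter> {0..} \<noteq> {}"
proof (rule ccontr)
  assume neg: "\<not> ?thesis"
  obtain u where u: "\<forall>b\<in>B. 0 \<le> u b" "sum u B = 1" "(\<Sum>b\<in>B. u b *\<^sub>R b) = x"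
    using assms(4) unfolding convex_hull_finite[OF assms(2)] by blast
  obtain h where h: "bij_betw h {..<card B} B"
    using ex_bij_betw_nat_finite[OF assms(2)] by (auto simp: atLeast0LessThan)
  have sums: "(\<Sum>i<card B. u (h i)) = 1" "(\<Sum>i<card B. u (h i) *\<^sub>R h i) = x"
    using u(2,3) sum.reindex_bij_betw[OF h, of u] sum.reindex_bij_betw[OF h, of "\<lambda>b. u b *\<^sub>R b"]
    by auto
  have hB: "h i \<in> B" if "i < card B" for i
    using h that by (auto simp: bij_betw_def)
  have "T (\<Sum>i<card B. u (h i) *\<^sub>R h i) \<subseteq> (\<Sum>i<card B. u (h i) *o T (h i))"
    using assms(3,5) sums hB u(1)
    by (intro assms(1)[unfolded set_concave_on_def, rule_format]) auto
  then obtain c where "c \<ge> 0" "c \<in> (\<Sum>i<card B. u (h i) *o T (h i))"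
    using assms(6) sums(2) by auto
  then obtain s where s: "0 \<le> (\<Sum>i<card B. s i)" "\<And>i. i < card B \<Longrightarrow> s i \<in> u (h i) *o T (h i)"
    by (auto simp: set_sum_alt)
  have s_le: "s i \<le> 0" and s_less: "u (h i) > 0 \<Longrightarrow> s i < 0" if "i < card B" for i
  proof -
    obtain c where c: "c \<in> T (h i)" "s i = u (h i) * c"
      using s(2)[OF \<open>i < card B\<close>] by (auto simp: elt_set_times_def)
    have "c < 0" using neg hB[OF \<open>i < card B\<close>] c(1) by force
    with c u(1) hB[OF \<open>i < card B\<close>] show "s i \<le> 0" "u (h i) > 0 \<Longrightarrow> s i < 0"
      by (auto simp: mult_nonneg_nonpos mult_pos_neg)
  qed
  \<comment> \<open>Zero weights give only \<open>s i \<le> 0\<close>; strictness comes from a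
    positive weight, which exists because the weights sum to 1.\<close>
  obtain i where "i < card B" "u (h i) > 0"
    using sums(1) sum_nonpos[of "{..<card B}" "\<lambda>i. u (h i)"] by (force simp: not_less)
  then have "(\<Sum>i<card B. s i) < (\<Sum>i<card B. 0)"
    using s_le s_less by (intro sum_strict_mono_ex1) auto
  with s(1) show False by simp
qed

theorem theorem3p3:
  fixes K D :: "'a::{locally_convex_space, t2_space} set"
    and F :: "'a \<Rightarrow> 'a \<Rightarrow> real set"
  assumes "K \<noteq> {}" and "convex K" and "compact K"
    and "D \<subseteq> K" and "self_segment_dense D K"
    and "\<And>y. y \<in> D \<Longrightarrow> usc_on K (\<lambda>x. F x y) K"
    and "\<And>x. x \<in> K \<Longrightarrow> usc_on K (\<lambda>y. F x y) (K - D)"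
    and "\<And>x. x \<in> D \<Longrightarrow> set_concave_on D (\<lambda>y. F x y)"
    and "\<And>x. x \<in> D \<Longrightarrow> F x x \<inter> {0..} \<noteq> {}"
  shows "\<exists>x0\<in>K. \<forall>y\<in>K. F x0 y \<inter> {0..} \<noteq> {}"
proof -
  define G where "G y = {x\<in>K. F x y \<inter> {0..} \<noteq> {}}" for y
  have cl: "closed (G y)" if "y \<in> D" for y
    using closedin_usc_meets[OF assms(6)[OF that], of "{0..}"] compact_imp_closed[OF assms(3)]
    unfolding G_def by (auto intro: closedin_closed_trans)
  have cover: "convex hull B \<subseteq> (\<Union>y\<in>B. G y)" if B: "finite B" "B \<subseteq> D" for B
  proof -
    have "x \<in> (\<Union>y\<in>B. G y)" if "x \<in> convex hull B \<inter> D" for x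
    proof -
      \<comment> \<open>Concavity is used for the map \<open>F x\<close> at its own index
        \<open>x\<close>, where the diagonal condition applies.\<close>
      have "\<exists>y\<in>B. F x y \<inter> {0..} \<noteq> {}"
        using that B assms(8,9) by (intro set_concave_on_nonneg[where x = x]) auto
      then show ?thesis
        using that assms(4) by (auto simp: G_def)
    qed
    then have "convex hull B \<inter> D \<subseteq> (\<Union>y\<in>B. G y)"
      by blast
    moreover have "closed (\<Union>y\<in>B. G y)"
      using B cl by (intro closed_UN) auto
    ultimately have "closure (convex hull B \<inter> D) \<subseteq> (\<Union>y\<in>B. G y)"
      by (rule closure_minimal)
    with self_segment_dense_convex_hull[OF assms(5) B] show ?thesis
      by (rule subset_trans)
  qed
  have "K \<inter> (\<Inter>y\<in>D. G y) \<noteq> {}"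
  proof (rule compact_imp_fip_image[OF assms(3) cl])
    fix B assume B: "finite B" "B \<subseteq> D"
    then have "(\<Inter>y\<in>B. G y) \<noteq> {}"
      by (intro KKM_finite cover) (auto intro: cl dest: finite_subset)
    then show "K \<inter> (\<Inter>y\<in>B. G y) \<noteq> {}"
      \<comment> \<open>The empty intersection is the whole space, so this case rests on
        \<open>K\<close> being nonempty.\<close>
      using assms(1) by (cases "B = {}") (auto simp: G_def)
  qed
  then obtain x0 where x0: "x0 \<in> K" "\<And>y. y \<in> D \<Longrightarrow> F x0 y \<inter> {0..} \<noteq> {}"
    by (auto simp: G_def)
  have "F x0 y \<inter> {0..} \<noteq> {}" if y: "y \<in> K - D" for y
  proof
    assume "F x0 y \<inter> {0..} = {}"
    then have "open {..<0::real}" "F x0 y \<subseteq> {..<0}" by (auto simp: not_le[symmetric])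
    then obtain M where M: "openin (top_of_set K) M" "y \<in> M" "\<forall>z\<in>M. F x0 z \<subseteq> {..<0}"
      using assms(7)[OF x0(1)] y unfolding usc_on_def usc_at_def by meson
    then obtain S where S: "open S" "M = K \<inter> S" by (auto simp: openin_open)
    \<comment> \<open>Every neighbourhood of \<open>y\<close> in \<open>K\<close> meets
      \<open>D\<close>, where the values of \<open>F x0\<close> already reach
      \<open>{0..}\<close>.\<close>
    have "y \<in> closure D"
      using assms(5) y unfolding self_segment_dense_def by blast
    then obtain z where "z \<in> D" "z \<in> S"
      using S M(2) open_Int_closure_eq_empty[of S D] by blast
    then have "F x0 z \<subseteq> {..<0}"
      using M(3) S(2) assms(4) by blast
    then show False
      using x0(2)[OF \<open>z \<in> D\<close>] by auto
  qed
  with x0 show ?thesis by blast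
qed

end
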